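(* The elementary abelian group $(\mathbb{Z}_3)^{10}$ is not a CI group.
   Context: Let $G$ be a finite group. For a subset $S \subseteq G$ with $S = S^{-1}$ (a symmetric subset), the Cayley graph $\mathrm{Cay}(G;S)$ is the undirected graph with vertex set $G$ in which $g$ and $h$ are adjacent if and only if $h \in Sg$ (loops are allowed, i.e. $S$ may contain the identity). A Cayley graph $\mathrm{Cay}(G;S)$ is a CI graph if, for every symmetric subset $S'$ of $G$ such that $\mathrm{Cay}(G;S) \cong \mathrm{Cay}(G;S')$, there is a group automorphism $\alpha$ of $G$ with $\alpha(S)=S'$. $G$ is a CI group if every Cayley graph of $G$ is a CI graph. *)

theory Defs
  imports
    "HOL-Algebra.Algebra"
    "Graph_Theory.Digraph_Isomorphism"
begin

definition symmetric_subset :: "('a, 'b) monoid_scheme \<Rightarrow> 'a set \<Rightarrow> bool"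
  where "symmetric_subset G S \<longleftrightarrow> S \<subseteq> carrier G \<and> set_inv\<^bsub>G\<^esub> S = S"

(* An undirected graph (loops allowed, no multiple edges) is represented by its adjacency
   relation as the arc set. For symmetric S the arc set is symmetric (lemma below). *)
definition cayley_graph :: "('a, 'b) monoid_scheme \<Rightarrow> 'a set \<Rightarrow> 'a pair_pre_digraph"
  where "cayley_graph G S =
    \<lparr>pverts = carrier G, parcs = {(g, h). g \<in> carrier G \<and> h \<in> S #>\<^bsub>G\<^esub> g}\<rparr>"

definition CI_graph :: "('a, 'b) monoid_scheme \<Rightarrow> 'a set \<Rightarrow> bool"
  where "CI_graph G S \<longleftrightarrow>
    (\<forall>S'. symmetric_subset G S' \<longrightarrow>
       digraph_iso (with_proj (cayley_graph G S)) (with_proj (cayley_graph G S')) \<longrightarrow>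
       (\<exists>\<alpha>\<in>iso G G. \<alpha> ` S = S'))"

definition CI_group :: "('a, 'b) monoid_scheme \<Rightarrow> bool"
  where "CI_group G \<longleftrightarrow> (\<forall>S. symmetric_subset G S \<longrightarrow> CI_graph G S)"

lemma (in group) pair_pseudo_graph_cayley_graph:
  assumes "finite (carrier G)" "symmetric_subset G S"
  shows "pair_pseudo_graph (cayley_graph G S)"
proof -
  have S: "S \<subseteq> carrier G" "\<And>s. s \<in> S \<Longrightarrow> inv s \<in> S"
    using assms(2) by (auto simp: symmetric_subset_def SET_INV_def)
  have sub: "S #> g \<subseteq> carrier G" if "g \<in> carrier G" for g
    using S that by (simp add: r_coset_subset_G)
  have sym: "g \<in> S #> h" if "g \<in> carrier G" "h \<in> S #> g" for g h
  proof -
    obtain s where s: "s \<in> S" "h = s \<otimes> g" using \<open>h \<in> S #> g\<close> by (auto simp: r_coset_def)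
    then have "g = inv s \<otimes> h" using S(1) \<open>g \<in> carrier G\<close> by (auto simp: m_assoc[symmetric])
    then show ?thesis using S(2)[OF s(1)] by (auto simp: r_coset_def)
  qed
  have arcs: "parcs (cayley_graph G S) \<subseteq> carrier G \<times> carrier G"
    using sub by (auto simp: cayley_graph_def)
  have "finite (parcs (cayley_graph G S))"
    by (rule finite_subset[OF arcs]) (simp add: assms(1))
  moreover have "Relation.sym (parcs (cayley_graph G S))"
    by (rule symI) (use sub sym in \<open>auto simp: cayley_graph_def\<close>)
  moreover have pv: "pverts (cayley_graph G S) = carrier G" by (simp add: cayley_graph_def)
  moreover have "fst e \<in> carrier G" "snd e \<in> carrier G" if "e \<in> parcs (cayley_graph G S)" for e
    using that arcs by auto
  ultimately show ?thesis
    by unfold_locales (simp_all add: symmetric_def assms(1))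
qed

(* The arc component of digraph_iso adds nothing for graphs without parallel arcs: it amounts to
   a bijection of the vertices preserving adjacency in both directions. *)
lemma (in group) digraph_iso_cayley_graph_iff:
  assumes "S \<subseteq> carrier G" "S' \<subseteq> carrier G"
  shows "digraph_iso (with_proj (cayley_graph G S)) (with_proj (cayley_graph G S')) \<longleftrightarrow>
    (\<exists>f. bij_betw f (carrier G) (carrier G) \<and>
      (\<forall>g\<in>carrier G. \<forall>h\<in>carrier G. h \<in> S #> g \<longleftrightarrow> f h \<in> S' #> f g))"
    (is "?L \<longleftrightarrow> ?R")
proof -
  have sub: "S #> g \<subseteq> carrier G" "S' #> g \<subseteq> carrier G" if "g \<in> carrier G" for g
    using assms that by (simp_all add: r_coset_subset_G)
  define A where "A = {(g, h). g \<in> carrier G \<and> h \<in> S #> g}"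
  define A' where "A' = {(g, h). g \<in> carrier G \<and> h \<in> S' #> g}"
  have A_sub: "A \<subseteq> carrier G \<times> carrier G" "A' \<subseteq> carrier G \<times> carrier G"
    using sub by (auto simp: A_def A'_def)
  have cay: "with_proj (cayley_graph G S) = \<lparr>verts = carrier G, arcs = A, tail = fst, head = snd\<rparr>"
    "with_proj (cayley_graph G S') = \<lparr>verts = carrier G, arcs = A', tail = fst, head = snd\<rparr>"
    by (simp_all add: cayley_graph_def with_proj_def A_def A'_def)
  have ?R if ?L
  proof -
    from that obtain F where
      F: "pre_digraph.digraph_isomorphism (with_proj (cayley_graph G S)) F"
        "with_proj (cayley_graph G S') = app_iso F (with_proj (cayley_graph G S))"
      by (auto simp: digraph_iso_def)
    let ?f = "iso_verts F"
    have H: "carrier G = ?f ` carrier G" "A' = iso_arcs F ` A" "iso_tail F = fst" "iso_head F = snd"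
      using F(2) by (auto simp: cay app_iso_def)
    have ends: "iso_arcs F a = (?f (fst a), ?f (snd a))" if "a \<in> A" for a
      using F(1) that H(3,4)
      by (auto simp: cay pre_digraph.digraph_isomorphism_def prod_eq_iff)
    have inj: "inj_on ?f (carrier G)"
      using F(1) by (auto simp: cay pre_digraph.digraph_isomorphism_def)
    have A': "A' = (\<lambda>a. (?f (fst a), ?f (snd a))) ` A"
      using H(2) ends by (metis (no_types, lifting) image_cong)
    have "(g, h) \<in> A \<longleftrightarrow> (?f g, ?f h) \<in> A'" if gh: "g \<in> carrier G" "h \<in> carrier G" for g h
    proof
      assume "(?f g, ?f h) \<in> A'"
      then obtain x y where xy: "(x, y) \<in> A" "?f g = ?f x" "?f h = ?f y"
        unfolding A' by auto
      then have "x \<in> carrier G" "y \<in> carrier G" using A_sub(1) by auto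
      then have "g = x" "h = y" using inj gh xy by (auto dest: inj_onD)
      then show "(g, h) \<in> A" using xy by simp
    qed (force simp: A')
    then have "h \<in> S #> g \<longleftrightarrow> ?f h \<in> S' #> ?f g" if "g \<in> carrier G" "h \<in> carrier G" for g h
      using that H(1) by (auto simp: A_def A'_def)
    then show ?thesis using inj H(1) by (auto simp: bij_betw_def intro!: exI[of _ ?f])
  qed
  moreover have ?L if ?R
  proof -
    from that obtain f where f: "bij_betw f (carrier G) (carrier G)"
      "\<And>g h. g \<in> carrier G \<Longrightarrow> h \<in> carrier G \<Longrightarrow> h \<in> S #> g \<longleftrightarrow> f h \<in> S' #> f g"
      by blast
    let ?F = "\<lparr>iso_verts = f, iso_arcs = map_prod f f, iso_head = snd, iso_tail = fst\<rparr>"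
    have inj: "inj_on f (carrier G)" and img: "f ` carrier G = carrier G"
      using f(1) by (auto simp: bij_betw_def)
    have fA: "(g, h) \<in> A \<longleftrightarrow> (f g, f h) \<in> A'" if "g \<in> carrier G" "h \<in> carrier G" for g h
      using f(2)[OF that] that img by (auto simp: A_def A'_def)
    have "A' = map_prod f f ` A"
    proof
      show "map_prod f f ` A \<subseteq> A'" using A_sub(1) fA by auto
      show "A' \<subseteq> map_prod f f ` A"
      proof
        fix a assume "a \<in> A'"
        moreover obtain x y where "a = (f x, f y)" "x \<in> carrier G" "y \<in> carrier G"
          using \<open>a \<in> A'\<close> A_sub(2) img by (cases a) blast
        ultimately show "a \<in> map_prod f f ` A" using fA by force
      qed
    qed
    moreover have "inj_on (map_prod f f) A"
      using map_prod_inj_on[OF inj inj] A_sub(1) by (rule inj_on_subset)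
    moreover have "wf_digraph (with_proj (cayley_graph G S))"
      using A_sub(1) by unfold_locales (auto simp: cay)
    ultimately show ?thesis
      using inj img unfolding digraph_iso_def
      by (intro exI[of _ ?F])
        (simp add: cay app_iso_def pre_digraph.digraph_isomorphism_def)
  qed
  ultimately show ?thesis by blast
qed

end

theory Submission
  imports Defs "HOL-Library.Function_Algebras" "HOL-Number_Theory.Cong"
begin

text \<open>
  Split the ten coordinates as U + W + Z of dimensions 3, 5, 2. The connection sets contain all
  of W + Z, and over each generic u in U a coset of the kernel of a linear functional l(u) on W
  (with Z-part 0): the kernel itself for the first set, the coset l(u) = c(u) for the second.
  With (x, y, z) the coordinates of U, the components x y^2, x y z, x z^2, y^2 z, y z^2 of the map
  \<phi> : U \<rightarrow> W are cubic, and the difference of l(u) \<circ> \<phi> in direction u is the constant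
  c(u) = x y^2 z^2; so translating the W-part by \<phi> is a graph isomorphism. An automorphism between
  the two sets would have to preserve W + Z; it would then yield a linear map M : U \<rightarrow> W with
  l(u)(M u) = c(u) for all generic u. But the tensors u \<otimes> l(u) satisfy a linear relation that the
  values c(u) violate.
\<close>

section \<open>Vectors modulo three\<close>

text \<open>Elements of the group are represented by arbitrary integer vectors, of which only the first
  ten coordinates matter: 0 to 2 for U, 3 to 7 for W, 8 and 9 for Z.\<close>

definition eq3 :: "(nat \<Rightarrow> int) \<Rightarrow> (nat \<Rightarrow> int) \<Rightarrow> bool" (infix "\<doteq>" 50)
  where "p \<doteq> q \<longleftrightarrow> (\<forall>i<10. [p i = q i] (mod 3))"

lemma eq3_refl [simp]: "p \<doteq> p"
  by (simp add: eq3_def)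

lemma eq3_sym: "p \<doteq> q \<Longrightarrow> q \<doteq> p"
  by (auto simp: eq3_def cong_sym_eq)

lemma eq3_trans [trans]: "p \<doteq> q \<Longrightarrow> q \<doteq> r \<Longrightarrow> p \<doteq> r"
  by (auto simp: eq3_def intro: cong_trans)

lemma eq3_add: "p \<doteq> q \<Longrightarrow> p' \<doteq> q' \<Longrightarrow> p + p' \<doteq> q + q'"
  by (auto simp: eq3_def intro: cong_add)

lemma eq3_diff: "p \<doteq> q \<Longrightarrow> p' \<doteq> q' \<Longrightarrow> p - p' \<doteq> q - q'"
  by (auto simp: eq3_def intro: cong_diff)

section \<open>The two connection sets\<close>

definition fibre :: "(nat \<Rightarrow> int) \<Rightarrow> bool"
  where "fibre q \<longleftrightarrow> 3 dvd q 0 \<and> 3 dvd q 1 \<and> 3 dvd q 2"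

text \<open>The line y = z = 0 is left out because the functional l(u) is zero there.\<close>

definition generic :: "(nat \<Rightarrow> int) \<Rightarrow> bool"
  where "generic q \<longleftrightarrow> \<not> 3 dvd q 0 \<and> (\<not> 3 dvd q 1 \<or> \<not> 3 dvd q 2)"

text \<open>This is l(u)(w) - t c(u) for the U-part u = (x, y, z) and W-part w of \<open>q\<close>;
  the coefficients of l(u) are z^2, y z, y^2, - x z, - x y.\<close>

definition form :: "int \<Rightarrow> (nat \<Rightarrow> int) \<Rightarrow> int"
  where "form t q = (q 2)\<^sup>2 * q 3 + q 1 * q 2 * q 4 + (q 1)\<^sup>2 * q 5
    - q 0 * (q 2 * q 6 + q 1 * q 7) - t * q 0 * (q 1)\<^sup>2 * (q 2)\<^sup>2"

text \<open>The Z-coordinates are free over the origin of U and zero over generic points; this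
  contrast lets linear maps recognise W + Z.\<close>

definition conn :: "int \<Rightarrow> (nat \<Rightarrow> int) \<Rightarrow> bool"
  where "conn t q \<longleftrightarrow> fibre q \<or> generic q \<and> 3 dvd q 8 \<and> 3 dvd q 9 \<and> 3 dvd form t q"

lemma eq3_dvd: "p \<doteq> q \<Longrightarrow> i < 10 \<Longrightarrow> 3 dvd p i \<longleftrightarrow> 3 dvd q i"
  by (auto simp: eq3_def cong_dvd_iff)

lemma eq3_fibre: "p \<doteq> q \<Longrightarrow> fibre p \<longleftrightarrow> fibre q"
  by (simp add: fibre_def eq3_dvd[of p q])

lemma eq3_generic: "p \<doteq> q \<Longrightarrow> generic p \<longleftrightarrow> generic q"
  by (simp add: generic_def eq3_dvd[of p q])

lemma eq3_form:
  assumes "p \<doteq> q"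
  shows "3 dvd form t p \<longleftrightarrow> 3 dvd form t q"
proof -
  have "[form t p = form t q] (mod 3)"
    unfolding form_def
    by (intro cong_add cong_diff cong_mult cong_pow cong_refl)
      (use assms in \<open>simp_all add: eq3_def\<close>)
  then show ?thesis by (rule cong_dvd_iff)
qed

lemma eq3_conn: "p \<doteq> q \<Longrightarrow> conn t p \<longleftrightarrow> conn t q"
  by (simp add: conn_def eq3_fibre[of p q] eq3_generic[of p q] eq3_form[of p q] eq3_dvd[of p q])

lemma fibre_add: "fibre p \<Longrightarrow> fibre q \<Longrightarrow> fibre (p + q)"
  by (simp add: fibre_def)

lemma fibre_diff: "fibre p \<Longrightarrow> fibre q \<Longrightarrow> fibre (p - q)"
  by (simp add: fibre_def)

lemma generic_not_fibre: "generic q \<Longrightarrow> \<not> fibre q"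
  by (auto simp: generic_def fibre_def)

text \<open>The monomials of \<open>form\<close> have odd total degree, 3 or 5, so negation only
  flips its sign. This makes the connection sets symmetric.\<close>

lemma conn_uminus: "conn t (- q) \<longleftrightarrow> conn t q"
proof -
  have "form t (- q) = - form t q"
    by (simp add: form_def algebra_simps)
  then show ?thesis
    by (simp add: conn_def fibre_def generic_def)
qed

section \<open>Translation by the cubic map \<phi>\<close>

definition twist :: "(nat \<Rightarrow> int) \<Rightarrow> (nat \<Rightarrow> int)"
  where "twist q = (\<lambda>_. 0)(3 := q 0 * (q 1)\<^sup>2, 4 := q 0 * q 1 * q 2, 5 := q 0 * (q 2)\<^sup>2,
    6 := (q 1)\<^sup>2 * q 2, 7 := q 1 * (q 2)\<^sup>2)"

text \<open>As l(u) is linear, the two forms differ by l(u)(\<phi>(p) - \<phi>(q)) - c(u), where u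
  is the U-part of \<open>p - q\<close>; this vanishes modulo 3.\<close>

lemma conn_twist: "conn 1 ((p + twist p) - (q + twist q)) \<longleftrightarrow> conn 0 (p - q)"
proof -
  let ?u = "p - q" and ?v = "(p + twist p) - (q + twist q)"
  \<comment> \<open>In U, (x', y, z) is the base point and (x, b, c) the increment.\<close>
  obtain x b c x' y z where xyz: "q 0 = x'" "q 1 = y" "q 2 = z"
    "p 0 = x' + x" "p 1 = y + b" "p 2 = z + c"
    by (metis add.commute diff_add_cancel)
  have "[form 1 ?v = form 0 ?u] (mod 3)"
    unfolding cong_iff_dvd_diff
  proof
    show "form 1 ?v - form 0 ?u = 3 * (b\<^sup>2 * c\<^sup>2 * x' + b\<^sup>2 * c * x' * z + b * c\<^sup>2 * x' * y - b * c * x * y * z)"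
      by (simp add: form_def twist_def xyz power2_eq_square algebra_simps del: One_nat_def)
  qed
  then have "3 dvd form 1 ?v \<longleftrightarrow> 3 dvd form 0 ?u"
    by (rule cong_dvd_iff)
  moreover have "?v i = ?u i" if "i \<in> {0, 1, 2, 8, 9}" for i
    using that by (auto simp: twist_def)
  ultimately show ?thesis
    by (simp add: conn_def fibre_def generic_def)
qed

section \<open>Additive maps between the connection sets\<close>

text \<open>Additive self-maps of the group, acting on integer vectors up to \<doteq>, so that
  polynomial identities can be computed over the integers.\<close>

locale additive3 =
  fixes a :: "(nat \<Rightarrow> int) \<Rightarrow> (nat \<Rightarrow> int)"
  assumes resp: "p \<doteq> q \<Longrightarrow> a p \<doteq> a q"
    and add: "a (p + q) \<doteq> a p + a q"
begin

lemma diff: "a (p - q) \<doteq> a p - a q"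
proof -
  have "a p \<doteq> a (p - q) + a q"
    using add[of "p - q" q] by simp
  then have "a p - a q \<doteq> a (p - q) + a q - a q"
    by (rule eq3_diff) simp
  then show ?thesis by (simp add: eq3_sym)
qed

lemma zero: "a 0 \<doteq> 0"
  using diff[of 0 0] by simp

lemma fibre_preserved:
  assumes conn: "\<And>q. conn s q \<Longrightarrow> conn t (a q)"
    and ker: "\<And>q. a q \<doteq> 0 \<Longrightarrow> q \<doteq> 0"
    and q: "fibre q"
  shows "fibre (a q)"
proof -
  \<comment> \<open>The image of W + Z has dimension 7, so it contains a nonzero vector vanishing in the
    coordinates 0, 3, ..., 7. Such a vector lies in Z, and adding it moves any connected vector
    outside W + Z to a disconnected one.\<close>
  define D where "D = (\<Pi>\<^sub>E i\<in>{3..<10::nat}. {0..<3::int})"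
  define J where "J = {0, 3, 4, 5, 6, 7::nat}"
  define ext where "ext d = (\<lambda>i. if i < 3 then 0 else d i)" for d :: "nat \<Rightarrow> int"
  \<comment> \<open>The coordinates in \<open>J\<close> of the image take at most 3^6 values on the
    3^7 vectors of \<open>D\<close>, so two vectors collide; their difference is the one
    sought.\<close>
  define g where "g d = (\<lambda>i\<in>J. a (ext d) i mod 3)" for d
  have "g ` D \<subseteq> (\<Pi>\<^sub>E i\<in>J. {0..<3})"
    by (auto simp: g_def)
  then have "card (g ` D) \<le> card (\<Pi>\<^sub>E i\<in>J. {0..<3::int})"
    by (intro card_mono finite_PiE) (auto simp: J_def)
  also have "\<dots> = 3 ^ 6"
    by (simp add: card_PiE J_def)
  also have "\<dots> < card D"
    by (simp add: card_PiE D_def)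
  finally have "\<not> inj_on g D"
    by (rule pigeonhole)
  then obtain d d' where d: "d \<in> D" "d' \<in> D" "g d = g d'" "d \<noteq> d'"
    by (auto simp: inj_on_def)
  define k where "k = ext d - ext d'"
  have "fibre k"
    by (simp add: k_def ext_def fibre_def)
  have "\<not> k \<doteq> 0"
  proof
    assume k: "k \<doteq> 0"
    have "d i = d' i" for i
    proof (cases "i \<in> {3..<10}")
      case True
      then have "d i mod 3 = d' i mod 3"
        using k by (auto simp: eq3_def k_def ext_def cong_diff_iff_cong_0 cong_def[of "d i"])
      moreover have "d i \<in> {0..<3}" "d' i \<in> {0..<3}"
        using d True by (auto simp: D_def)
      ultimately show ?thesis by simp
    next
      case False
      then show ?thesis using d by (auto simp: D_def PiE_def extensional_def)
    qed
    then show False using d by blast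
  qed
  have J: "3 dvd a k i" if "i \<in> J" for i
  proof -
    have "g d i = g d' i"
      using d by simp
    then have "[a (ext d) i - a (ext d') i = 0] (mod 3)"
      using that by (simp add: g_def cong_def[of "a _ _"] cong_diff_iff_cong_0)
    moreover have "[a k i = a (ext d) i - a (ext d') i] (mod 3)"
      using diff[of "ext d" "ext d'"] that by (auto simp: eq3_def k_def J_def)
    ultimately show ?thesis
      by (metis cong_0_iff cong_trans)
  qed
  have "conn t (a k)"
    using conn \<open>fibre k\<close> by (simp add: conn_def)
  \<comment> \<open>Coordinate 0 belongs to \<open>J\<close> for this purpose: its vanishing
    excludes generic vectors, which leaves only the fibre.\<close>
  then have ak: "fibre (a k)"
    using J[of 0] by (auto simp: conn_def generic_def J_def)
  have 89: "\<not> (3 dvd a k 8 \<and> 3 dvd a k 9)"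
  proof
    assume "3 dvd a k 8 \<and> 3 dvd a k 9"
    moreover have "i \<in> J \<or> i \<in> {1, 2, 8, 9}" if "i < 10" for i
      using that by (auto simp: J_def)
    ultimately have "a k \<doteq> 0"
      using ak J by (fastforce simp: eq3_def fibre_def cong_0_iff)
    then show False
      using ker \<open>\<not> k \<doteq> 0\<close> by blast
  qed
  show ?thesis
  proof (rule ccontr)
    assume nf: "\<not> fibre (a q)"
    have sum: "a q + a k \<doteq> a (q + k)"
      using add by (rule eq3_sym)
    have "conn t (a q)" "conn t (a (q + k))"
      using conn q \<open>fibre k\<close> fibre_add by (simp_all add: conn_def)
    then have c: "conn t (a q)" "conn t (a q + a k)"
      using eq3_conn[OF sum] by simp_all
    moreover have "\<not> fibre (a q + a k)"
      using fibre_diff[OF _ ak, of "a q + a k"] nf by auto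
    ultimately have "3 dvd a q 8" "3 dvd a q 9" "3 dvd a q 8 + a k 8" "3 dvd a q 9 + a k 9"
      using nf by (auto simp: conn_def)
    then show False
      using 89 by (simp add: dvd_add_right_iff)
  qed
qed

end

text \<open>The U-parts of \<open>d + e\<close> and \<open>d - e\<close> are (1, y, z) and (-1, y,
  z). The coefficients of coordinates 3 to 5 are independent of x, while those of 6 and 7 and the
  term c(u) are odd in x; so the former keep only \<open>e\<close> and the latter only
  \<open>d\<close>.\<close>

lemma form_difference:
  assumes "e 0 = 1" "e 1 = 0" "e 2 = 0" "d 0 = 0"
  shows "form 1 (d + e) - form 1 (d - e) = 2 * ((d 2)\<^sup>2 * e 3 + d 1 * d 2 * e 4 + (d 1)\<^sup>2 * e 5
    - d 2 * d 6 - d 1 * d 7 - (d 1)\<^sup>2 * (d 2)\<^sup>2)"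
  by (simp add: form_def assms del: One_nat_def)
    (simp add: power2_eq_square algebra_simps del: One_nat_def)

text \<open>The relation among the tensors u \<otimes> l(u): the W-coordinates of e1, e2, e3 cancel modulo 3,
  while the sum of the values c(u) survives.\<close>

lemma form_combination:
  assumes "e1 0 = 1" "e1 1 = 0" "e1 2 = 0" "e2 0 = 0" "e2 1 = 1" "e2 2 = 0"
    "e3 0 = 0" "e3 1 = 0" "e3 2 = 1"
  shows "(\<Sum>d\<leftarrow>[e2, e3, e2 + e3, e2 - e3]. form 1 (d + e1) - form 1 (d - e1))
    = 3 * (2 * (e1 3 + e1 5 - e2 7 - e3 6) - 1) - 1"
  by (simp add: form_difference assms del: One_nat_def)

text \<open>Since W + Z is preserved, the image of U has exactly one vector modulo 3 over each
  generic point, and \<open>form 1\<close> vanishes at it because \<open>form 0\<close> vanishes on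
  U. Closure of the image under sums and differences then contradicts
  \<open>form_combination\<close>.\<close>

lemma additive3_no_equivalence:
  assumes "additive3 a" "additive3 b"
    and ab: "\<And>q. a (b q) \<doteq> q" and ba: "\<And>q. b (a q) \<doteq> q"
    and conn: "\<And>q. conn 0 q \<longleftrightarrow> conn 1 (a q)"
  shows False
proof -
  interpret a: additive3 a by fact
  interpret b: additive3 b by fact
  have ker: "q \<doteq> 0" if "a q \<doteq> 0" for q
    using b.resp[OF that] ba[of q] b.zero by (meson eq3_sym eq3_trans)
  have ker': "q \<doteq> 0" if "b q \<doteq> 0" for q
    using a.resp[OF that] ab[of q] a.zero by (meson eq3_sym eq3_trans)
  have conn': "conn 0 (b q)" if "conn 1 q" for q
    using that conn[of "b q"] eq3_conn[OF ab[of q]] by simp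
  have fibre: "fibre (a q) \<longleftrightarrow> fibre q" for q
  proof
    assume "fibre (a q)"
    then have "fibre (b (a q))"
      using b.fibre_preserved[OF conn' ker'] by blast
    then show "fibre q"
      using eq3_fibre[OF ba] by blast
  qed (use a.fibre_preserved[of 0 1 q] conn ker in blast)
  \<comment> \<open>The image of U, which turns out to be the graph of a linear map from U to W + Z.\<close>
  define R where "R p \<longleftrightarrow> (\<exists>u. (\<forall>i\<ge>3. u i = 0) \<and> p \<doteq> a u)" for p
  have R_add: "R (p + q)" if pq: "R p" "R q" for p q
  proof -
    obtain u v where uv: "\<forall>i\<ge>3. u i = 0" "p \<doteq> a u" "\<forall>i\<ge>3. v i = 0" "q \<doteq> a v"
      using pq unfolding R_def by blast
    have "p + q \<doteq> a (u + v)"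
      using eq3_add[OF uv(2,4)] eq3_sym[OF a.add] by (rule eq3_trans)
    then show ?thesis
      unfolding R_def using uv by (intro exI[of _ "u + v"]) simp
  qed
  have R_diff: "R (p - q)" if pq: "R p" "R q" for p q
  proof -
    obtain u v where uv: "\<forall>i\<ge>3. u i = 0" "p \<doteq> a u" "\<forall>i\<ge>3. v i = 0" "q \<doteq> a v"
      using pq unfolding R_def by blast
    have "p - q \<doteq> a (u - v)"
      using eq3_diff[OF uv(2,4)] eq3_sym[OF a.diff] by (rule eq3_trans)
    then show ?thesis
      unfolding R_def using uv by (intro exI[of _ "u - v"]) simp
  qed
  have lift: "\<exists>p. R p \<and> p 0 = x \<and> p 1 = y \<and> p 2 = z \<and> 3 dvd form 1 p"
    if v: "\<not> 3 dvd x" "\<not> 3 dvd y \<or> \<not> 3 dvd z" for x y z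
  proof -
    \<comment> \<open>The entry at coordinate 3, multiplied by z^2, cancels c(u), so
      \<open>form 1 r\<close> is zero.\<close>
    define r :: "nat \<Rightarrow> int" where "r = (\<lambda>_. 0)(0 := x, 1 := y, 2 := z, 3 := x * y\<^sup>2)"
    have r: "generic r" "conn 1 r"
      using v by (simp_all add: r_def generic_def conn_def form_def)
    define s where "s = b r"
    have as: "a s \<doteq> r"
      using ab by (simp add: s_def)
    \<comment> \<open>Projecting \<open>s\<close> to U changes it by an element of W + Z, so
      \<open>a u\<close> still lies over (x, y, z).\<close>
    define u where "u = (\<lambda>i. if i < 3 then s i else 0)"
    have "generic s"
    proof -
      have "\<not> fibre s"
        using fibre[of s] eq3_fibre[OF as] generic_not_fibre r by blast
      moreover have "conn 0 s"
        using conn' r by (simp add: s_def)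
      ultimately show ?thesis by (simp add: conn_def)
    qed
    then have "generic u"
      by (simp add: u_def generic_def)
    then have "conn 0 u"
      by (simp add: conn_def form_def u_def)
    then have "3 dvd form 1 (a u)" "\<not> fibre (a u)"
      using conn[of u] fibre[of u] generic_not_fibre \<open>generic u\<close> by (auto simp: conn_def)
    have "fibre (a (s - u))"
      by (simp add: fibre) (simp add: fibre_def u_def)
    then have f: "fibre (a s - a u)"
      using eq3_fibre[OF a.diff] by blast
    \<comment> \<open>The U-coordinates are made equal to x, y, z as integers, not just modulo 3, as
      the polynomial identities require.\<close>
    define p where "p = (a u)(0 := x, 1 := y, 2 := z)"
    have "[a u i = r i] (mod 3)" if "i < 3" for i
    proof -
      have "[a s i = r i] (mod 3)"
        using as that by (simp add: eq3_def)
      moreover have "[a s i = a u i] (mod 3)"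
      proof -
        have "i \<in> {0, 1, 2}" using that by auto
        then show ?thesis using f by (auto simp: fibre_def cong_iff_dvd_diff)
      qed
      ultimately show ?thesis
        by (meson cong_sym cong_trans)
    qed
    from this[of 0] this[of 1] this[of 2] have "p \<doteq> a u"
      by (auto simp: eq3_def p_def r_def cong_sym_eq)
    then have "R p"
      unfolding R_def by (intro exI[of _ u]) (simp add: u_def)
    moreover have "3 dvd form 1 p"
      using eq3_form[OF \<open>p \<doteq> a u\<close>] \<open>3 dvd form 1 (a u)\<close> by blast
    ultimately show ?thesis
      by (intro exI[of _ p]) (simp add: p_def)
  qed
  \<comment> \<open>The vector given by \<open>lift\<close> is the only one of \<open>R\<close> over
    its point modulo 3, because U meets W + Z only in 0.\<close>
  have R_form: "3 dvd form 1 p" if p: "R p" "generic p" for p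
  proof -
    obtain p' where p': "R p'" "p' 0 = p 0" "p' 1 = p 1" "p' 2 = p 2" "3 dvd form 1 p'"
      using lift[of "p 0" "p 1" "p 2"] p(2) unfolding generic_def by blast
    obtain w where w: "\<forall>i\<ge>3. w i = 0" "p - p' \<doteq> a w"
      using R_diff[OF p(1) p'(1)] by (auto simp: R_def)
    have "fibre (p - p')"
      using p' by (simp add: fibre_def)
    then have "fibre w"
      using eq3_fibre[OF w(2)] fibre by blast
    have "w \<doteq> 0"
    proof -
      have "3 dvd w i" for i
      proof (cases "i < 3")
        case True
        then have "i \<in> {0, 1, 2}" by auto
        then show ?thesis using \<open>fibre w\<close> by (auto simp: fibre_def)
      qed (use w in simp)
      then show ?thesis by (simp add: eq3_def cong_0_iff)
    qed
    then have "p - p' \<doteq> 0"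
      using w(2) a.resp[of w 0] a.zero by (meson eq3_trans)
    then have "p - p' + p' \<doteq> 0 + p'"
      by (rule eq3_add) simp
    then have "p \<doteq> p'" by simp
    then show ?thesis
      using eq3_form p'(5) by blast
  qed
  \<comment> \<open>The basis vectors of U are not generic, so their lifts are built from those of
    three generic points.\<close>
  obtain A where A: "R A" "A 0 = 1" "A 1 = 1" "A 2 = 0"
    using lift[of 1 1 0] by auto
  obtain B where B: "R B" "B 0 = 1" "B 1 = 0" "B 2 = 1"
    using lift[of 1 0 1] by auto
  obtain C where C: "R C" "C 0 = 1" "C 1 = 1" "C 2 = 1"
    using lift[of 1 1 1] by auto
  define e1 e2 e3 where "e1 = A + B - C" and "e2 = C - B" and "e3 = C - A"
  have R: "R e1" "R e2" "R e3"
    using A B C by (simp_all add: e1_def e2_def e3_def R_add R_diff)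
  have e: "e1 0 = 1" "e1 1 = 0" "e1 2 = 0" "e2 0 = 0" "e2 1 = 1" "e2 2 = 0"
    "e3 0 = 0" "e3 1 = 0" "e3 2 = 1"
    using A B C by (simp_all add: e1_def e2_def e3_def)
  \<comment> \<open>Here x is 1 or -1, and (y, z) runs through one representative of each of the
    four lines of the plane modulo 3.\<close>
  have "3 dvd form 1 (e2 + e1)" "3 dvd form 1 (e2 - e1)"
    "3 dvd form 1 (e3 + e1)" "3 dvd form 1 (e3 - e1)"
    "3 dvd form 1 (e2 + e3 + e1)" "3 dvd form 1 (e2 + e3 - e1)"
    "3 dvd form 1 (e2 - e3 + e1)" "3 dvd form 1 (e2 - e3 - e1)"
    using R e by (intro R_form R_add R_diff; simp add: generic_def del: One_nat_def)+
  then have "3 dvd (\<Sum>d\<leftarrow>[e2, e3, e2 + e3, e2 - e3]. form 1 (d + e1) - form 1 (d - e1))"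
    by simp
  then show False
    unfolding form_combination[OF e] by presburger
qed

section \<open>The Cayley graphs\<close>

abbreviation Z3_10 :: "(nat \<Rightarrow> int) monoid"
  where "Z3_10 \<equiv> product_group {..<10} (\<lambda>_. integer_mod_group 3)"

lemma carrier_Z3_10: "carrier Z3_10 = (\<Pi>\<^sub>E i\<in>{..<10}. {0..<3})"
  by (simp add: carrier_integer_mod_group)

lemma group_Z3_10: "group Z3_10"
  by simp

text \<open>The canonical representative: group elements are extensional functions with values in
  \<open>{0..<3}\<close>.\<close>

definition red :: "(nat \<Rightarrow> int) \<Rightarrow> (nat \<Rightarrow> int)"
  where "red q = (\<lambda>i\<in>{..<10}. q i mod 3)"

lemma red_closed: "red q \<in> carrier Z3_10"
  by (auto simp: red_def carrier_integer_mod_group)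

lemma red_eq_iff: "red p = red q \<longleftrightarrow> p \<doteq> q"
  by (auto simp: red_def eq3_def cong_def fun_eq_iff restrict_def)

lemma red_eq3: "red q \<doteq> q"
  by (simp add: red_def eq3_def)

lemma red_id: "q \<in> carrier Z3_10 \<Longrightarrow> red q = q"
  unfolding carrier_Z3_10 by (auto simp: red_def PiE_def extensional_def fun_eq_iff Pi_iff)

lemma mult_Z3_10: "p \<otimes>\<^bsub>Z3_10\<^esub> q = red (p + q)"
  by (simp add: red_def)

lemma inv_Z3_10:
  assumes "q \<in> carrier Z3_10"
  shows "inv\<^bsub>Z3_10\<^esub> q = red (- q)"
proof (rule group.inv_equality[OF group_Z3_10 _ assms red_closed])
  have "red (- q) + q \<doteq> - q + q"
    by (rule eq3_add) (simp_all add: red_eq3)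
  then have "red (red (- q) + q) = red 0"
    by (simp add: red_eq_iff)
  then show "red (- q) \<otimes>\<^bsub>Z3_10\<^esub> q = \<one>\<^bsub>Z3_10\<^esub>"
    unfolding mult_Z3_10 by (simp add: red_def)
qed

definition connset :: "int \<Rightarrow> (nat \<Rightarrow> int) set"
  where "connset t = {q \<in> carrier Z3_10. conn t q}"

lemma connset_rcoset_iff:
  assumes "g \<in> carrier Z3_10" "h \<in> carrier Z3_10"
  shows "h \<in> connset t #>\<^bsub>Z3_10\<^esub> g \<longleftrightarrow> conn t (h - g)"
proof
  assume "h \<in> connset t #>\<^bsub>Z3_10\<^esub> g"
  then obtain s where s: "conn t s" "h = red (s + g)"
    by (auto simp: r_coset_def connset_def mult_Z3_10 simp del: mult_product_group)
  have "h - g \<doteq> s + g - g"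
    unfolding s(2) by (rule eq3_diff) (simp_all add: red_eq3)
  then show "conn t (h - g)"
    using s(1) eq3_conn by force
next
  assume c: "conn t (h - g)"
  have "red (h - g) \<in> connset t"
    using c red_closed eq3_conn[OF red_eq3] unfolding connset_def by blast
  moreover have "h = red (h - g) \<otimes>\<^bsub>Z3_10\<^esub> g"
  proof -
    have "red (h - g) + g \<doteq> h - g + g"
      by (rule eq3_add) (simp_all add: red_eq3)
    then have "red (red (h - g) + g) = red h"
      by (simp add: red_eq_iff)
    then show ?thesis
      unfolding mult_Z3_10 using red_id assms by simp
  qed
  ultimately show "h \<in> connset t #>\<^bsub>Z3_10\<^esub> g"
    unfolding r_coset_def by blast
qed

lemma symmetric_connset: "symmetric_subset Z3_10 (connset t)"
proof -
  have sub: "connset t \<subseteq> carrier Z3_10"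
    unfolding connset_def by blast
  have inv: "inv\<^bsub>Z3_10\<^esub> q \<in> connset t" if "q \<in> connset t" for q
  proof -
    have "conn t (red (- q))"
      using that eq3_conn[OF red_eq3] conn_uminus unfolding connset_def by blast
    moreover have "q \<in> carrier Z3_10"
      using that sub by blast
    ultimately show ?thesis
      unfolding connset_def using inv_Z3_10 red_closed by auto
  qed
  have "connset t \<subseteq> set_inv\<^bsub>Z3_10\<^esub> (connset t)"
  proof
    fix q assume q: "q \<in> connset t"
    then have "inv\<^bsub>Z3_10\<^esub> (inv\<^bsub>Z3_10\<^esub> q) = q"
      using group.inv_inv[OF group_Z3_10] sub by blast
    moreover have "inv\<^bsub>Z3_10\<^esub> (inv\<^bsub>Z3_10\<^esub> q) \<in> set_inv\<^bsub>Z3_10\<^esub> (connset t)"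
      using inv[OF q] unfolding SET_INV_def by blast
    ultimately show "q \<in> set_inv\<^bsub>Z3_10\<^esub> (connset t)"
      by (simp only:)
  qed
  moreover have "set_inv\<^bsub>Z3_10\<^esub> (connset t) \<subseteq> connset t"
    using inv unfolding SET_INV_def by blast
  ultimately show ?thesis
    unfolding symmetric_subset_def using sub by blast
qed

section \<open>The graph isomorphism\<close>

lemma eq3_twist:
  assumes "\<And>i. i < 3 \<Longrightarrow> [p i = q i] (mod 3)"
  shows "twist p \<doteq> twist q"
proof -
  have "[p 0 = q 0] (mod 3)" "[p 1 = q 1] (mod 3)" "[p 2 = q 2] (mod 3)"
    using assms by simp_all
  then show ?thesis
    by (simp add: eq3_def twist_def cong_mult cong_pow del: One_nat_def)
qed

text \<open>Translation by \<open>twist\<close> respects adjacency by \<open>conn_twist\<close>.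
  Subtracting \<open>twist\<close> inverts it, since \<open>twist\<close> depends only on the
  U-coordinates, which both maps fix.\<close>

lemma digraph_iso_connset:
  "digraph_iso (with_proj (cayley_graph Z3_10 (connset 0))) (with_proj (cayley_graph Z3_10 (connset 1)))"
proof -
  define f where "f q = red (q + twist q)" for q
  define f' where "f' q = red (q - twist q)" for q
  have "f' (f q) = q" if "q \<in> carrier Z3_10" for q
  proof -
    have "[(f q) i = q i] (mod 3)" if "i < 3" for i
      using that by (simp add: f_def red_def twist_def cong_def)
    then have "twist (f q) \<doteq> twist q"
      by (rule eq3_twist)
    then have "f q - twist (f q) \<doteq> q + twist q - twist q"
      unfolding f_def by (intro eq3_diff red_eq3)
    then have "red (f q - twist (f q)) = red q"
      by (simp add: red_eq_iff)
    then show ?thesis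
      unfolding f'_def red_id[OF that] .
  qed
  moreover have "f (f' q) = q" if "q \<in> carrier Z3_10" for q
  proof -
    have "[(f' q) i = q i] (mod 3)" if "i < 3" for i
      using that by (simp add: f'_def red_def twist_def cong_def)
    then have "twist (f' q) \<doteq> twist q"
      by (rule eq3_twist)
    then have "f' q + twist (f' q) \<doteq> q - twist q + twist q"
      unfolding f'_def by (intro eq3_add red_eq3)
    then have "red (f' q + twist (f' q)) = red q"
      by (simp add: red_eq_iff)
    then show ?thesis
      unfolding f_def red_id[OF that] .
  qed
  ultimately have "bij_betw f (carrier Z3_10) (carrier Z3_10)"
    by (intro bij_betw_byWitness[of _ f'])
      (auto simp: f_def f'_def red_closed simp del: carrier_product_group)
  moreover have "h \<in> connset 0 #>\<^bsub>Z3_10\<^esub> g \<longleftrightarrow> f h \<in> connset 1 #>\<^bsub>Z3_10\<^esub> f g"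
    if gh: "g \<in> carrier Z3_10" "h \<in> carrier Z3_10" for g h
  proof -
    have "f h - f g \<doteq> (h + twist h) - (g + twist g)"
      unfolding f_def by (intro eq3_diff red_eq3)
    then have "conn 1 (f h - f g) \<longleftrightarrow> conn 0 (h - g)"
      using eq3_conn conn_twist by blast
    then show ?thesis
      using connset_rcoset_iff gh red_closed unfolding f_def by blast
  qed
  ultimately have "\<exists>f. bij_betw f (carrier Z3_10) (carrier Z3_10) \<and>
      (\<forall>g\<in>carrier Z3_10. \<forall>h\<in>carrier Z3_10.
        h \<in> connset 0 #>\<^bsub>Z3_10\<^esub> g \<longleftrightarrow> f h \<in> connset 1 #>\<^bsub>Z3_10\<^esub> f g)"
    by blast
  moreover have "connset t \<subseteq> carrier Z3_10" for t
    unfolding connset_def by blast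
  ultimately show ?thesis
    by (simp only: group.digraph_iso_cayley_graph_iff[OF group_Z3_10])
qed

section \<open>Group automorphisms as additive maps of integer vectors\<close>

lemma iso_additive3:
  assumes "\<alpha> \<in> iso Z3_10 Z3_10"
  shows "additive3 (\<lambda>q. \<alpha> (red q))"
proof
  show "\<alpha> (red p) \<doteq> \<alpha> (red q)" if "p \<doteq> q" for p q
    using that red_eq_iff[of p q] by simp
  have hom: "\<alpha> \<in> hom Z3_10 Z3_10"
    using assms by (simp add: iso_def)
  show "\<alpha> (red (p + q)) \<doteq> \<alpha> (red p) + \<alpha> (red q)" for p q
  proof -
    have "red p + red q \<doteq> p + q"
      by (rule eq3_add) (rule red_eq3)+
    then have "red (p + q) = red p \<otimes>\<^bsub>Z3_10\<^esub> red q"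
      unfolding mult_Z3_10 by (simp add: red_eq_iff eq3_sym)
    then have "\<alpha> (red (p + q)) = red (\<alpha> (red p) + \<alpha> (red q))"
      using hom_mult[OF hom red_closed red_closed] by (simp only: mult_Z3_10)
    then show ?thesis
      by (simp add: red_eq3)
  qed
qed

theorem corollary1p4:
  shows "\<not> CI_group (product_group {..<10::nat} (\<lambda>_. integer_mod_group 3))"
proof
  assume "CI_group Z3_10"
  then obtain \<alpha> where \<alpha>: "\<alpha> \<in> iso Z3_10 Z3_10" "\<alpha> ` connset 0 = connset 1"
    unfolding CI_group_def CI_graph_def
    using symmetric_connset digraph_iso_connset by blast
  define \<beta> where "\<beta> = inv_into (carrier Z3_10) \<alpha>"
  have \<beta>: "\<beta> \<in> iso Z3_10 Z3_10"
    unfolding \<beta>_def using group.iso_set_sym[OF group_Z3_10 \<alpha>(1)] .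
  have bij: "bij_betw \<alpha> (carrier Z3_10) (carrier Z3_10)"
    using \<alpha>(1) unfolding iso_def by blast
  have closed: "\<alpha> (red q) \<in> carrier Z3_10" for q
    using bij_betwE[OF bij] red_closed by blast
  have closed': "\<beta> (red q) \<in> carrier Z3_10" for q
    unfolding \<beta>_def using bij_betwE[OF bij_betw_inv_into[OF bij]] red_closed by blast
  show False
  proof (rule additive3_no_equivalence[OF iso_additive3[OF \<alpha>(1)] iso_additive3[OF \<beta>]])
    show "\<alpha> (red (\<beta> (red q))) \<doteq> q" for q
      using bij_betw_inv_into_right[OF bij red_closed] red_id[OF closed'] red_eq3
      by (simp add: \<beta>_def)
    show "\<beta> (red (\<alpha> (red q))) \<doteq> q" for q
      using bij_betw_inv_into_left[OF bij red_closed] red_id[OF closed] red_eq3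
      by (simp add: \<beta>_def)
    show "conn 0 q \<longleftrightarrow> conn 1 (\<alpha> (red q))" for q
    proof -
      have "conn 0 q \<longleftrightarrow> red q \<in> connset 0"
        unfolding connset_def using red_closed eq3_conn[OF red_eq3] by blast
      \<comment> \<open>Injectivity of \<alpha> turns the equality of sets into a pointwise
        equivalence.\<close>
      also have "\<dots> \<longleftrightarrow> \<alpha> (red q) \<in> \<alpha> ` connset 0"
      proof -
        have "connset 0 \<subseteq> carrier Z3_10"
          unfolding connset_def by blast
        then show ?thesis
          using inj_on_image_mem_iff[OF bij_betw_imp_inj_on[OF bij] red_closed] by blast
      qed
      also have "\<dots> \<longleftrightarrow> conn 1 (\<alpha> (red q))"
        unfolding \<alpha>(2) using closed by (simp add: connset_def del: carrier_product_group)
      finally show ?thesis .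
    qed
  qed
qed

end
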